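(* Any $n\times n$ strictly upper triangular matrix $M$ of an $rc$-formation is CN-realizable. That is: let $1\le k<l\le n$ and let $I,J$ be integers with $k<J<l$, $k<I<l$ and $I-J\le 1$. Let $M=M_1+M_2+M_3$, where $M_1$ is the $n\times n$ matrix with the $r(k,J)$-formation, $M_2$ is the $n\times n$ matrix with the $c(I,l)$-formation, and $M_3$ is the $n\times n$ matrix with $M_3(k,l)=2$ and all other entries zero. Then $M$ is CN-realizable.
   Context: Formations. The $n\times n$ matrix with the $r(k,J)$-formation has $(k,j)$ entry equal to $2$ for $k+1\le j\le J$ and all other entries $0$. The $n\times n$ matrix with the $c(I,l)$-formation has $(i,l)$ entry equal to $2$ for $I\le i\le l-1$ and all other entries $0$. Braid projections. An $n$-braid projection $B$ consists of $n$ strands in the plane, each running monotonically downward from one of $n$ points on an upper horizontal bar to one of $n$ points on a lower horizontal bar, meeting each other only in finitely many transverse double points (crossings), with no over/under information. The strands are named $s_1,\dots,s_n$ from left to right at the top. Combinatorially, $B$ is encoded by a finite word with letters in $\{1,\dots,n-1\}$: reading from top to bottom, the letter $k$ means that the two strands currently in positions $k$ and $k+1$ cross once and exchange positions (no reduction is assumed). The CN matrix $N(B)$ is the symmetric zero-diagonal $n\times n$ matrix whose $(i,j)$ entry ($i\neq j$) is the number of crossings between $s_i$ and $s_j$. CN matrices are represented by strictly upper triangular matrices: a strictly upper triangular $n\times n$ matrix $M$ is CN-realizable if there is an $n$-braid projection $B$ with $M(i,j)=N(B)(i,j)$ for all $1\le i<j\le n$. *)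

theory Defs
  imports "HOL-Combinatorics.Transposition" "Jordan_Normal_Form.Matrix"
begin

text \<open>Matrices of type \<^typ>\<open>nat mat\<close> are indexed from 0, whereas strands, positions and matrix
  entries are numbered from 1 here; the next two definitions do the conversion.\<close>

definition sq_mat :: "nat \<Rightarrow> (nat \<Rightarrow> nat \<Rightarrow> nat) \<Rightarrow> nat mat" where
  "sq_mat n f = mat n n (\<lambda>(i, j). f (i + 1) (j + 1))"

definition entry :: "nat mat \<Rightarrow> nat \<Rightarrow> nat \<Rightarrow> nat" where
  "entry M i j = M $$ (i - 1, j - 1)"

definition strictly_upper_triangular :: "nat \<Rightarrow> nat mat \<Rightarrow> bool" where
  "strictly_upper_triangular n M \<longleftrightarrow>
     M \<in> carrier_mat n n \<and> (\<forall>i\<in>{1..n}. \<forall>j\<in>{1..n}. j \<le> i \<longrightarrow> entry M i j = 0)"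

text \<open>An \<open>n\<close>-braid projection is the word of its crossings, read from top to bottom: the letter \<open>k\<close>
  lets the strands in positions \<open>k\<close> and \<open>k + 1\<close> cross once. Words are not assumed reduced.\<close>

definition braid_projection :: "nat \<Rightarrow> nat list \<Rightarrow> bool" where
  "braid_projection n w \<longleftrightarrow> set w \<subseteq> {1..<n}"

text \<open>\<open>strand_at w p\<close> is the index of the strand in position \<open>p\<close> below all crossings of \<open>w\<close>;
  strands are numbered by their positions at the top.\<close>

definition strand_at :: "nat list \<Rightarrow> nat \<Rightarrow> nat" where
  "strand_at w = fold (\<lambda>k f. f \<circ> Transposition.transpose k (k + 1)) w id"

definition crossings :: "nat list \<Rightarrow> nat \<Rightarrow> nat \<Rightarrow> nat" where
  "crossings w i j =
     card {m. m < length w \<and>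
       {strand_at (take m w) (w ! m), strand_at (take m w) (w ! m + 1)} = {i, j}}"

definition CN_matrix :: "nat \<Rightarrow> nat list \<Rightarrow> nat mat" where
  "CN_matrix n w = sq_mat n (\<lambda>i j. if i = j then 0 else crossings w i j)"

definition CN_realizable :: "nat \<Rightarrow> nat mat \<Rightarrow> bool" where
  "CN_realizable n M \<longleftrightarrow>
     strictly_upper_triangular n M \<and>
     (\<exists>w. braid_projection n w \<and>
        (\<forall>i j. 1 \<le> i \<and> i < j \<and> j \<le> n \<longrightarrow> entry M i j = entry (CN_matrix n w) i j))"

definition r_formation :: "nat \<Rightarrow> nat \<Rightarrow> nat \<Rightarrow> nat mat" where
  "r_formation n k J = sq_mat n (\<lambda>i j. if i = k \<and> k + 1 \<le> j \<and> j \<le> J then 2 else 0)"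

definition c_formation :: "nat \<Rightarrow> nat \<Rightarrow> nat \<Rightarrow> nat mat" where
  "c_formation n I l = sq_mat n (\<lambda>i j. if I \<le> i \<and> i \<le> l - 1 \<and> j = l then 2 else 0)"

end

theory Submission
  imports Defs
begin

text \<open>Let strand \<open>k\<close> run to the right across \<open>k + 1, \<dots>, J\<close>, then let strand \<open>l\<close> run to the
  left until it has crossed both \<open>k\<close> and \<open>I\<close>. Since \<open>I \<le> J + 1\<close>, no strand besides
  \<open>k, I, \<dots>, l - 1\<close> is in its way. So far every pair has crossed at most once; appending the
  mirror image of this word doubles all crossing numbers.\<close>

lemma strand_at_Nil [simp]: "strand_at [] = id"
  by (simp add: strand_at_def)

lemma strand_at_snoc [simp]: "strand_at (w @ [a]) = strand_at w \<circ> transpose a (a + 1)"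
  by (simp add: strand_at_def)

lemma bij_strand_at: "bij (strand_at w)"
  by (induction w rule: rev_induct)
    (simp_all only: strand_at_Nil strand_at_snoc bij_id bij_comp bij_transpose)

lemma crossings_Nil [simp]: "crossings [] i j = 0"
  by (simp add: crossings_def)

text \<open>Turns the count over crossing indices into a recursion for induction from the end:
  prefixes inside \<open>w\<close> are unaffected by \<open>a\<close>, so \<open>length w\<close> is
  the only index that can be new.\<close>

lemma crossings_snoc [simp]:
  "crossings (w @ [a]) i j = crossings w i j + of_bool ({strand_at w a, strand_at w (a + 1)} = {i, j})"
proof -
  let ?A = "{m. m < length w \<and>
      {strand_at (take m w) (w ! m), strand_at (take m w) (w ! m + 1)} = {i, j}}"
  let ?P = "{strand_at w a, strand_at w (a + 1)} = {i, j}"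
  let ?Q = "\<lambda>m. {strand_at (take m (w @ [a])) ((w @ [a]) ! m),
      strand_at (take m (w @ [a])) ((w @ [a]) ! m + 1)} = {i, j}"
  have "{m. m < length (w @ [a]) \<and> ?Q m} = ?A \<union> (if ?P then {length w} else {})"
  proof (rule Set.set_eqI)
    fix m
    consider "m < length w" | "m = length w" | "m > length w"
      by linarith
    then show "m \<in> {m. m < length (w @ [a]) \<and> ?Q m} \<longleftrightarrow> m \<in> ?A \<union> (if ?P then {length w} else {})"
      by cases (simp_all add: nth_append)
  qed
  moreover have "finite ?A" "length w \<notin> ?A"
    by simp_all
  ultimately show ?thesis
    by (simp add: crossings_def)
qed

text \<open>What a suffix contributes depends only on the permutation reached before it. The
  equation is in additive form to avoid subtraction on \<open>nat\<close>.\<close>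

lemma crossings_append_cong:
  assumes "strand_at u = strand_at v"
  shows "strand_at (u @ x) = strand_at (v @ x)
    \<and> crossings (u @ x) i j + crossings v i j = crossings (v @ x) i j + crossings u i j"
proof (induction x rule: rev_induct)
  case Nil
  then show ?case using assms by simp
next
  case (snoc a x)
  then show ?case
    using strand_at_snoc[of "u @ x" a] strand_at_snoc[of "v @ x" a]
      crossings_snoc[of "u @ x" a i j] crossings_snoc[of "v @ x" a i j]
    by simp
qed

lemma crossings_append_rev: "crossings (u @ rev u) i j = 2 * crossings u i j"
proof (induction u rule: rev_induct)
  case Nil
  then show ?case by simp
next
  case (snoc a u)
  have "strand_at ((u @ [a]) @ [a]) = strand_at u"
    unfolding strand_at_snoc by (simp add: fun_eq_iff)
  from crossings_append_cong[OF this, of "rev u" i j]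
  have "crossings (u @ [a] @ [a] @ rev u) i j + crossings u i j
    = crossings (u @ rev u) i j + crossings ((u @ [a]) @ [a]) i j"
    by simp
  \<comment> \<open>The second \<open>a\<close> meets the same two strands in swapped positions,
    hence the same unordered pair.\<close>
  also have "crossings ((u @ [a]) @ [a]) i j
    = crossings u i j + 2 * of_bool ({strand_at u a, strand_at u (a + 1)} = {i, j})"
    unfolding crossings_snoc strand_at_snoc by (simp add: insert_commute)
  finally show ?case using snoc by simp
qed

text \<open>One strand travels right from position \<open>k\<close> to \<open>m\<close>; each strand
  it passes slips one position to the left.\<close>

lemma strand_at_upt:
  "k \<le> m \<Longrightarrow> strand_at [k..<m] p = (if p = m then k else if k \<le> p \<and> p < m then p + 1 else p)"
proof (induction m arbitrary: p rule: dec_induct)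
  case base
  then show ?case by simp
next
  case (step m)
  then show ?case
    by (auto simp: transpose_def)
qed

text \<open>When letter \<open>m\<close> is appended, strand \<open>k\<close> is in position
  \<open>m\<close>, next to the still unmoved strand \<open>m + 1\<close>.\<close>

lemma crossings_upt:
  assumes "k \<le> m" "i < j"
  shows "crossings [k..<m] i j = of_bool (i = k \<and> j \<le> m)"
  using assms(1)
proof (induction m rule: dec_induct)
  case base
  then show ?case using assms(2) by simp
next
  case (step m)
  then show ?case
    using assms(2) by (auto simp: strand_at_upt doubleton_eq_iff)
qed

text \<open>The mirror case below an arbitrary \<open>v\<close>: the strand in position
  \<open>l\<close> travels left to \<open>m\<close>, pushing those it passes one position to the
  right.\<close>

lemma strand_at_append_rev_upt:
  "m \<le> l \<Longrightarrow> strand_at (v @ rev [m..<l]) p =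
     strand_at v (if p = m then l else if m < p \<and> p \<le> l then p - 1 else p)"
proof (induction m arbitrary: p rule: inc_induct)
  case base
  then show ?case by simp
next
  case (step m)
  have "rev [m..<l] = rev [Suc m..<l] @ [m]"
    using step.hyps by (simp add: upt_conv_Cons)
  then have "strand_at (v @ rev [m..<l]) = strand_at (v @ rev [Suc m..<l]) \<circ> transpose m (m + 1)"
    using strand_at_snoc[of "v @ rev [Suc m..<l]" m] by simp
  with step show ?case
    by (auto simp: transpose_def)
qed

lemma crossings_append_rev_upt:
  "m \<le> l \<Longrightarrow> crossings (v @ rev [m..<l]) i j =
     crossings v i j + of_bool (\<exists>p\<in>{m..<l}. {strand_at v p, strand_at v l} = {i, j})"
proof (induction m rule: inc_induct)
  case base
  then show ?case by simp
next
  case (step m)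
  let ?f = "strand_at v"
  have "rev [m..<l] = rev [Suc m..<l] @ [m]"
    using step.hyps by (simp add: upt_conv_Cons)
  then have "crossings (v @ rev [m..<l]) i j
    = crossings (v @ rev [Suc m..<l]) i j + of_bool ({?f m, ?f l} = {i, j})"
    using crossings_snoc[of "v @ rev [Suc m..<l]" m i j] step.hyps
    by (simp add: strand_at_append_rev_upt)
  \<comment> \<open>Distinct positions hold distinct strands, so each pair occurs for at most one
    \<open>p\<close> and the two \<open>of_bool\<close> terms merge into a single one.\<close>
  moreover have "?f p \<noteq> ?f m" if "p \<in> {Suc m..<l}" for p
    using that inj_eq[OF bij_is_inj[OF bij_strand_at]] by simp
  then have "\<not> ({?f m, ?f l} = {i, j} \<and> (\<exists>p\<in>{Suc m..<l}. {?f p, ?f l} = {i, j}))"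
    by (auto simp: doubleton_eq_iff)
  moreover have "{m..<l} = insert m {Suc m..<l}"
    using step.hyps by auto
  ultimately show ?case
    using step.IH by auto
qed

lemma entry_sq_mat:
  "1 \<le> i \<Longrightarrow> i \<le> n \<Longrightarrow> 1 \<le> j \<Longrightarrow> j \<le> n \<Longrightarrow> entry (sq_mat n f) i j = f i j"
  by (simp add: entry_def sq_mat_def)

lemma sq_mat_add: "sq_mat n f + sq_mat n g = sq_mat n (\<lambda>i j. f i j + g i j)"
  by (rule eq_matI) (auto simp: sq_mat_def)

theorem proposition14:
  fixes n k l I J :: nat and M M1 M2 M3 :: "nat mat"
  assumes "1 \<le> k" and "k < l" and "l \<le> n"
    and "k < J" and "J < l"
    and "k < I" and "I < l"
    and "int I - int J \<le> 1"
    and "M1 = r_formation n k J"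
    and "M2 = c_formation n I l"
    and "M3 = sq_mat n (\<lambda>i j. if i = k \<and> j = l then 2 else 0)"
    and "M = M1 + M2 + M3"
  shows "CN_realizable n M"
proof -
  define v where "v = [k..<J]"
  \<comment> \<open>The leftward run ends at \<open>I - 1\<close>: below \<open>v\<close>, strand
    \<open>I\<close> is there if \<open>I \<le> J\<close>, and strand \<open>k\<close> if
    \<open>I = J + 1\<close>.\<close>
  define u where "u = v @ rev [I - 1..<l]"
  define g :: "nat \<Rightarrow> nat \<Rightarrow> nat" where "g i j =
    (if i = k \<and> k + 1 \<le> j \<and> j \<le> J then 2 else 0) +
    (if I \<le> i \<and> i \<le> l - 1 \<and> j = l then 2 else 0) +
    (if i = k \<and> j = l then 2 else 0)" for i j
  have M: "M = sq_mat n g"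
    unfolding assms(9-12) r_formation_def c_formation_def sq_mat_add g_def ..
  have IJ: "I \<le> J + 1"
    using assms(8) by linarith
  have f: "strand_at v p = (if p = J then k else if k \<le> p \<and> p < J then p + 1 else p)" for p
    unfolding v_def using assms(4) by (intro strand_at_upt) simp
  have last: "(\<exists>p\<in>{I - 1..<l}. {strand_at v p, strand_at v l} = {i, j})
      \<longleftrightarrow> j = l \<and> (i = k \<or> I \<le> i \<and> i < l)" if "i < j" for i j
  proof
    assume "\<exists>p\<in>{I - 1..<l}. {strand_at v p, strand_at v l} = {i, j}"
    then show "j = l \<and> (i = k \<or> I \<le> i \<and> i < l)"
      using that IJ assms(4-7) by (auto simp: f doubleton_eq_iff split: if_splits)
  next
    assume *: "j = l \<and> (i = k \<or> I \<le> i \<and> i < l)"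
    \<comment> \<open>The position of strand \<open>i\<close> below \<open>v\<close>:
      \<open>k\<close> has moved to \<open>J\<close>, the strands it passed are shifted left by one,
      those beyond \<open>J\<close> are unmoved.\<close>
    define p where "p = (if i = k then J else if i \<le> J then i - 1 else i)"
    have p: "p \<in> {I - 1..<l}" "strand_at v p = i" "strand_at v l = l"
      using * IJ assms(4-7) by (auto simp: p_def f)
    then show "\<exists>p\<in>{I - 1..<l}. {strand_at v p, strand_at v l} = {i, j}"
      using * by (intro bexI[OF _ p(1)]) (simp add: p)
  qed
  have "crossings (u @ rev u) i j = g i j" if "i < j" for i j
  proof -
    have "crossings v i j = of_bool (i = k \<and> j \<le> J)"
      unfolding v_def using assms(4) that by (intro crossings_upt) auto
    then have "crossings u i j = of_bool (i = k \<and> j \<le> J) + of_bool (j = l \<and> (i = k \<or> I \<le> i \<and> i < l))"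
      unfolding u_def using assms(7) last[OF that] by (simp add: crossings_append_rev_upt)
    then show ?thesis
      \<comment> \<open>The three summands of \<open>g\<close> have disjoint supports because
        \<open>J < l\<close> and \<open>k < I\<close>, so no entry exceeds 2.\<close>
      unfolding crossings_append_rev g_def using that assms(4-7) by auto
  qed
  then have "\<forall>i j. 1 \<le> i \<and> i < j \<and> j \<le> n \<longrightarrow> entry M i j = entry (CN_matrix n (u @ rev u)) i j"
    by (simp add: M CN_matrix_def entry_sq_mat)
  moreover have "braid_projection n (u @ rev u)"
    using assms(1-7) by (auto simp: braid_projection_def u_def v_def)
  moreover have "g i j = 0" if "j \<le> i" for i j
    using that assms(2) by (auto simp: g_def)
  then have "strictly_upper_triangular n M"
    by (simp add: strictly_upper_triangular_def M entry_sq_mat) (simp add: sq_mat_def)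
  ultimately show ?thesis
    unfolding CN_realizable_def by blast
qed

end
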